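(* Let $G$ be a finite additive abelian group and let $\varphi\in\operatorname{Aut}(G)$ be a fixed-point free automorphism. Then the following hold: (1) $C_{\operatorname{Aut}(G)}(\varphi)=\operatorname{Aut}(\operatorname{Alex}(G,\varphi))_0$ (equality of sets of maps $G\to G$). (2) $\operatorname{Aut}(\operatorname{Alex}(G,\varphi))\cong G\rtimes C_{\operatorname{Aut}(G)}(\varphi)$. (3) $\operatorname{Inn}(\operatorname{Alex}(G,\varphi))\cong G\rtimes\langle\varphi\rangle$.
   Context: A quandle is a set $X$ with a binary operation $*$ such that: (i) $a*a=a$ for all $a\in X$; (ii) for any $a,b\in X$ there is a unique $c\in X$ with $a=c*b$; (iii) $(a*b)*c=(a*c)*(b*c)$ for all $a,b,c\in X$. An automorphism of a quandle $X$ is a bijection $f:X\to X$ with $f(a*b)=f(a)*f(b)$; these form the group $\operatorname{Aut}(X)$ under composition. For $x\in X$, the map $S_x:X\to X$, $S_x(y)=y*x$, is an automorphism of $X$; $\operatorname{Inn}(X)$ denotes the subgroup of $\operatorname{Aut}(X)$ generated by all $S_x$, $x\in X$. For an additive abelian group $G$ and a group automorphism $\varphi\in\operatorname{Aut}(G)$, the Alexander quandle $\operatorname{Alex}(G,\varphi)$ is the set $G$ with operation $a*b=\varphi(a)-\varphi(b)+b$. The automorphism $\varphi$ is fixed-point free if $\varphi(a)=a$ implies $a=0$. $C_{\operatorname{Aut}(G)}(\varphi)$ is the centraliser of $\varphi$ in the group $\operatorname{Aut}(G)$ of group automorphisms of $G$, and $\langle\varphi\rangle$ is the cyclic subgroup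 of $\operatorname{Aut}(G)$ generated by $\varphi$. $\operatorname{Aut}(\operatorname{Alex}(G,\varphi))_0=\{f\in\operatorname{Aut}(\operatorname{Alex}(G,\varphi)) : f(0)=0\}$ is the isotropy subgroup at $0$. In (2) and (3) the semidirect products are taken with respect to the natural action of subgroups of $\operatorname{Aut}(G)$ on $G$, so that $(a_1,f_1)(a_2,f_2)=(a_1+f_1(a_2),f_1f_2)$. The symbol $\cong$ denotes isomorphism of groups. *)

theory Defs
  imports "HOL-Algebra.Algebra"
begin

section \<open>Quandles\<close>

record 'a quandle = "'a partial_object" +
  qop :: "'a \<Rightarrow> 'a \<Rightarrow> 'a" (infixl "\<triangleright>\<index>" 70)

locale quandle =
  fixes Q :: "('a, 'b) quandle_scheme" (structure)
  assumes closed: "\<lbrakk>a \<in> carrier Q; b \<in> carrier Q\<rbrakk> \<Longrightarrow> a \<triangleright> b \<in> carrier Q"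
    and idem: "a \<in> carrier Q \<Longrightarrow> a \<triangleright> a = a"
    and right_div: "\<lbrakk>a \<in> carrier Q; b \<in> carrier Q\<rbrakk> \<Longrightarrow> \<exists>!c. c \<in> carrier Q \<and> a = c \<triangleright> b"
    and right_distrib: "\<lbrakk>a \<in> carrier Q; b \<in> carrier Q; c \<in> carrier Q\<rbrakk>
      \<Longrightarrow> (a \<triangleright> b) \<triangleright> c = (a \<triangleright> c) \<triangleright> (b \<triangleright> c)"

text \<open>As with \<^const>\<open>auto\<close> and \<^const>\<open>AutoGroup\<close> for groups, maps on a carrier set are
  represented by functions that are \<^const>\<open>undefined\<close> outside it, so that equality of HOL
  functions is equality of maps on the carrier.\<close>

definition qauto :: "('a, 'b) quandle_scheme \<Rightarrow> ('a \<Rightarrow> 'a) set"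
  where "qauto Q = {f \<in> Bij (carrier Q).
    \<forall>a\<in>carrier Q. \<forall>b\<in>carrier Q. f (a \<triangleright>\<^bsub>Q\<^esub> b) = f a \<triangleright>\<^bsub>Q\<^esub> f b}"

definition QAutoGroup :: "('a, 'b) quandle_scheme \<Rightarrow> ('a \<Rightarrow> 'a) monoid"
  where "QAutoGroup Q = BijGroup (carrier Q) \<lparr>carrier := qauto Q\<rparr>"

definition right_mult :: "('a, 'b) quandle_scheme \<Rightarrow> 'a \<Rightarrow> 'a \<Rightarrow> 'a"
  where "right_mult Q x = (\<lambda>y\<in>carrier Q. y \<triangleright>\<^bsub>Q\<^esub> x)"

definition QInnGroup :: "('a, 'b) quandle_scheme \<Rightarrow> ('a \<Rightarrow> 'a) monoid"
  where "QInnGroup Q = (QAutoGroup Q)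
    \<lparr>carrier := generate (QAutoGroup Q) (right_mult Q ` carrier Q)\<rparr>"

definition qauto_fixing :: "('a, 'b) quandle_scheme \<Rightarrow> 'a \<Rightarrow> ('a \<Rightarrow> 'a) set"
  where "qauto_fixing Q x = {f \<in> qauto Q. f x = x}"


section \<open>Alexander quandles and automorphisms of groups\<close>

text \<open>The abelian group \<^term>\<open>G\<close> is written multiplicatively, following
  \<^locale>\<open>comm_group\<close>: the product below is \<open>\<phi>(a) - \<phi>(b) + b\<close> in additive notation.\<close>

definition Alex :: "('a, 'b) monoid_scheme \<Rightarrow> ('a \<Rightarrow> 'a) \<Rightarrow> 'a quandle"
  where "Alex G \<phi> = \<lparr>carrier = carrier G,
    qop = (\<lambda>a b. \<phi> a \<otimes>\<^bsub>G\<^esub> inv\<^bsub>G\<^esub> (\<phi> b) \<otimes>\<^bsub>G\<^esub> b)\<rparr>"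

definition fixed_point_free :: "('a, 'b) monoid_scheme \<Rightarrow> ('a \<Rightarrow> 'a) \<Rightarrow> bool"
  where "fixed_point_free G \<phi> \<longleftrightarrow> (\<forall>a\<in>carrier G. \<phi> a = a \<longrightarrow> a = \<one>\<^bsub>G\<^esub>)"

definition centraliser :: "('a, 'b) monoid_scheme \<Rightarrow> 'a \<Rightarrow> 'a set"
  where "centraliser K x = {y \<in> carrier K. y \<otimes>\<^bsub>K\<^esub> x = x \<otimes>\<^bsub>K\<^esub> y}"

text \<open>Semidirect product of \<^term>\<open>G\<close> with a subgroup \<^term>\<open>H\<close> of \<^term>\<open>AutoGroup G\<close>, with
  respect to the natural action of \<^term>\<open>H\<close> on \<^term>\<open>G\<close>.\<close>

definition semidirect :: "('a, 'b) monoid_scheme \<Rightarrow> ('a \<Rightarrow> 'a) set \<Rightarrow> ('a \<times> ('a \<Rightarrow> 'a)) monoid"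
  where "semidirect G H = \<lparr>carrier = carrier G \<times> H,
    monoid.mult = (\<lambda>(a\<^sub>1, f\<^sub>1) (a\<^sub>2, f\<^sub>2). (a\<^sub>1 \<otimes>\<^bsub>G\<^esub> f\<^sub>1 a\<^sub>2, f\<^sub>1 \<otimes>\<^bsub>AutoGroup G\<^esub> f\<^sub>2)),
    monoid.one = (\<one>\<^bsub>G\<^esub>, \<one>\<^bsub>AutoGroup G\<^esub>)\<rparr>"


section \<open>Well-definedness\<close>

lemma (in quandle) subgroup_qauto: "subgroup (qauto Q) (BijGroup (carrier Q))"
proof (rule subgroup.intro)
  show "qauto Q \<subseteq> carrier (BijGroup (carrier Q))"
    by (auto simp: qauto_def BijGroup_def)
next
  fix f g assume "f \<in> qauto Q" "g \<in> qauto Q"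
  then show "f \<otimes>\<^bsub>BijGroup (carrier Q)\<^esub> g \<in> qauto Q"
    using Bij_imp_funcset[of f "carrier Q"] Bij_imp_funcset[of g "carrier Q"]
      compose_Bij[of f "carrier Q" g]
    by (auto simp: qauto_def BijGroup_def compose_eq closed Pi_iff)
next
  show "\<one>\<^bsub>BijGroup (carrier Q)\<^esub> \<in> qauto Q"
    by (auto simp: qauto_def BijGroup_def id_Bij closed)
next
  fix f assume f: "f \<in> qauto Q"
  then have B: "f \<in> Bij (carrier Q)" by (simp add: qauto_def)
  have "inv_into (carrier Q) f (a \<triangleright> b) = inv_into (carrier Q) f a \<triangleright> inv_into (carrier Q) f b"
    if "a \<in> carrier Q" "b \<in> carrier Q" for a b
    by (rule Bij_inv_into_lemma[OF _ B _ that]) (use f closed in \<open>auto simp: qauto_def\<close>)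
  then show "inv\<^bsub>BijGroup (carrier Q)\<^esub> f \<in> qauto Q"
    using B by (auto simp: inv_BijGroup qauto_def restrict_inv_into_Bij closed
        simp del: restrict_apply intro: Bij_inv_into_mem)
       (simp add: closed Bij_inv_into_mem)
qed

lemma (in quandle) group_QAutoGroup: "group (QAutoGroup Q)"
  by (simp add: QAutoGroup_def subgroup.subgroup_is_group subgroup_qauto group_BijGroup)

lemma (in quandle) right_mult_qauto:
  assumes "x \<in> carrier Q" shows "right_mult Q x \<in> qauto Q"
proof -
  have "bij_betw (\<lambda>y. y \<triangleright> x) (carrier Q) (carrier Q)"
    unfolding bij_betw_def
  proof
    show "inj_on (\<lambda>y. y \<triangleright> x) (carrier Q)"
      by (rule inj_onI) (metis assms closed right_div)
    show "(\<lambda>y. y \<triangleright> x) ` carrier Q = carrier Q"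
    proof
      show "(\<lambda>y. y \<triangleright> x) ` carrier Q \<subseteq> carrier Q"
        using assms closed by blast
      show "carrier Q \<subseteq> (\<lambda>y. y \<triangleright> x) ` carrier Q"
        using right_div[OF _ assms] by blast
    qed
  qed
  then show ?thesis
    using right_distrib[OF _ _ assms]
    by (simp add: qauto_def right_mult_def Bij_def closed)
qed

lemma (in quandle) group_QInnGroup: "group (QInnGroup Q)"
proof -
  interpret A: group "QAutoGroup Q" by (rule group_QAutoGroup)
  have "right_mult Q ` carrier Q \<subseteq> carrier (QAutoGroup Q)"
    by (auto simp: QAutoGroup_def right_mult_qauto)
  then show ?thesis
    unfolding QInnGroup_def by (intro A.subgroup_imp_group A.generate_is_subgroup)
qed

lemma (in comm_group) quandle_Alex:
  assumes "\<phi> \<in> auto G" shows "quandle (Alex G \<phi>)"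
proof -
  have hom: "\<phi> \<in> hom G G" and bij: "bij_betw \<phi> (carrier G) (carrier G)"
    using assms by (simp_all add: auto_def Bij_def)
  have cl [simp]: "a \<in> carrier G \<Longrightarrow> \<phi> a \<in> carrier G" for a
    using hom by (auto simp: hom_def)
  have mul: "\<lbrakk>a \<in> carrier G; b \<in> carrier G\<rbrakk> \<Longrightarrow> \<phi> (a \<otimes> b) = \<phi> a \<otimes> \<phi> b" for a b
    using hom by (auto simp: hom_def)
  have in': "a \<in> carrier G \<Longrightarrow> \<phi> (inv a) = inv (\<phi> a)" for a
    using hom group_hom.hom_inv[of G G \<phi> a] by (simp add: group_hom_def group_hom_axioms_def)
  have canc: "x \<otimes> (inv x \<otimes> y) = y" "inv x \<otimes> (x \<otimes> y) = y"
    if "x \<in> carrier G" "y \<in> carrier G" for x y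
    using that by (simp_all add: m_assoc[symmetric])
  show ?thesis
  proof
    fix a b assume a: "a \<in> carrier (Alex G \<phi>)" and b: "b \<in> carrier (Alex G \<phi>)"
    then have [simp]: "a \<in> carrier G" "b \<in> carrier G" by (auto simp: Alex_def)
    show "a \<triangleright>\<^bsub>Alex G \<phi>\<^esub> b \<in> carrier (Alex G \<phi>)" by (simp add: Alex_def)
    obtain c where c: "c \<in> carrier G" "\<phi> c = a \<otimes> (inv b \<otimes> \<phi> b)"
    proof -
      have "a \<otimes> (inv b \<otimes> \<phi> b) \<in> \<phi> ` carrier G"
        using bij by (simp add: bij_betw_def)
      then show ?thesis using that by force
    qed
    have eq: "a = \<phi> c \<otimes> inv (\<phi> b) \<otimes> b"
      by (simp add: c m_assoc canc)
    have "\<exists>!c. c \<in> carrier G \<and> a = \<phi> c \<otimes> inv (\<phi> b) \<otimes> b"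
    proof (rule ex1I[of _ c])
      show "c \<in> carrier G \<and> a = \<phi> c \<otimes> inv (\<phi> b) \<otimes> b" using c(1) eq by (rule conjI)
      fix d assume d: "d \<in> carrier G \<and> a = \<phi> d \<otimes> inv (\<phi> b) \<otimes> b"
      have "\<phi> d \<otimes> inv (\<phi> b) \<otimes> b = \<phi> c \<otimes> inv (\<phi> b) \<otimes> b"
        by (rule trans[OF sym[OF conjunct2[OF d]] eq])
      then have "\<phi> d = \<phi> c"
        using c(1) conjunct1[OF d] by simp
      then show "d = c" using c(1) conjunct1[OF d] bij by (meson bij_betw_def inj_onD)
    qed
    then show "\<exists>!c. c \<in> carrier (Alex G \<phi>) \<and> a = c \<triangleright>\<^bsub>Alex G \<phi>\<^esub> b" by (simp add: Alex_def)
  next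
    fix a assume "a \<in> carrier (Alex G \<phi>)"
    then show "a \<triangleright>\<^bsub>Alex G \<phi>\<^esub> a = a" by (simp add: Alex_def)
  next
    fix a b c
    assume "a \<in> carrier (Alex G \<phi>)" "b \<in> carrier (Alex G \<phi>)" "c \<in> carrier (Alex G \<phi>)"
    then have [simp]: "a \<in> carrier G" "b \<in> carrier G" "c \<in> carrier G" by (auto simp: Alex_def)
    let ?p = "\<phi> (\<phi> a)" and ?q = "\<phi> (\<phi> b)" and ?r = "\<phi> (\<phi> c)"
    have 1: "\<phi> (\<phi> a \<otimes> inv \<phi> c \<otimes> c) = ?p \<otimes> (inv ?r \<otimes> \<phi> c)"
            "\<phi> (\<phi> b \<otimes> inv \<phi> c \<otimes> c) = ?q \<otimes> (inv ?r \<otimes> \<phi> c)"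
            "\<phi> (\<phi> a \<otimes> inv \<phi> b \<otimes> b) = ?p \<otimes> (inv ?q \<otimes> \<phi> b)"
      by (simp_all add: mul in' m_assoc)
    have 2: "x \<otimes> t \<otimes> inv (y \<otimes> t) = x \<otimes> inv y"
      if "x \<in> carrier G" "y \<in> carrier G" "t \<in> carrier G" for x y t
      using that by (simp add: inv_mult_group m_assoc canc)
    show "a \<triangleright>\<^bsub>Alex G \<phi>\<^esub> b \<triangleright>\<^bsub>Alex G \<phi>\<^esub> c =
          a \<triangleright>\<^bsub>Alex G \<phi>\<^esub> c \<triangleright>\<^bsub>Alex G \<phi>\<^esub> (b \<triangleright>\<^bsub>Alex G \<phi>\<^esub> c)"
      unfolding Alex_def quandle.simps 1 by (simp add: 2) (simp add: m_assoc)
  qed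
qed

lemma (in group) subgroup_centraliser:
  assumes "x \<in> carrier G" shows "subgroup (centraliser G x) G"
proof
  show "y \<otimes> z \<in> centraliser G x" if "y \<in> centraliser G x" "z \<in> centraliser G x" for y z
    using that assms by (auto simp: centraliser_def) (metis m_assoc)
  show "inv y \<in> centraliser G x" if "y \<in> centraliser G x" for y
    using that assms
    by (auto simp: centraliser_def) (metis inv_closed inv_solve_left inv_solve_right m_assoc m_closed)
qed (use assms in \<open>auto simp: centraliser_def\<close>)

lemma (in group) group_semidirect:
  assumes "subgroup H (AutoGroup G)" shows "group (semidirect G H)"
proof -
  interpret A: group "AutoGroup G" by (rule AutoGroup)
  interpret H: subgroup H "AutoGroup G" by (rule assms)
  have H: "f \<in> hom G G" "f \<in> Bij (carrier G)" if "f \<in> H" for f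
    using H.subset that by (auto simp: AutoGroup_def auto_def)
  have cl: "f a \<in> carrier G" if "f \<in> H" "a \<in> carrier G" for f a
    using H[OF that(1)] that(2) by (auto simp: hom_def)
  have mul: "f (a \<otimes> b) = f a \<otimes> f b" if "f \<in> H" "a \<in> carrier G" "b \<in> carrier G" for f a b
    using H[OF that(1)] that by (auto simp: hom_def)
  have app: "(f \<otimes>\<^bsub>AutoGroup G\<^esub> g) a = f (g a)" if "f \<in> H" "g \<in> H" "a \<in> carrier G" for f g a
    using H that by (simp add: AutoGroup_def BijGroup_def compose_def)
  have idn: "\<one>\<^bsub>AutoGroup G\<^esub> a = a" if "a \<in> carrier G" for a
    using that by (simp add: AutoGroup_def BijGroup_def)
  show ?thesis
  proof (rule groupI)
    show "\<exists>y\<in>carrier (semidirect G H). y \<otimes>\<^bsub>semidirect G H\<^esub> x = \<one>\<^bsub>semidirect G H\<^esub>"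
      if "x \<in> carrier (semidirect G H)" for x
    proof -
      obtain a f where x: "x = (a, f)" "a \<in> carrier G" "f \<in> H"
        using \<open>x \<in> _\<close> by (auto simp: semidirect_def)
      let ?g = "inv\<^bsub>AutoGroup G\<^esub> f"
      have "(inv (?g a), ?g) \<in> carrier (semidirect G H)"
        using x by (simp add: semidirect_def cl)
      moreover have "(inv (?g a), ?g) \<otimes>\<^bsub>semidirect G H\<^esub> x = \<one>\<^bsub>semidirect G H\<^esub>"
        using x by (simp add: semidirect_def cl A.l_inv[OF H.mem_carrier])
      ultimately show ?thesis by blast
    qed
  qed (use A.m_assoc[OF H.mem_carrier H.mem_carrier H.mem_carrier] in
    \<open>auto simp: semidirect_def cl mul app idn m_assoc A.l_one[OF H.mem_carrier]\<close>)
qed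

end

theory Submission
  imports Defs
begin

text \<open>Write \<open>G\<close> additively and put \<open>\<delta>(b) = b - \<phi>(b)\<close>, so that the quandle operation is
  \<open>a * b = \<phi>(a) + \<delta>(b)\<close>. The map \<open>\<delta>\<close> is an endomorphism of \<open>G\<close>; fixed-point freeness says that
  its kernel is trivial, and since \<open>G\<close> is finite it is then onto (\<open>delta_surj\<close>). Everything below
  rests on this surjectivity.

  Let \<open>f\<close> be a quandle automorphism with \<open>f(0) = 0\<close>. Applying \<open>f\<close> to \<open>a * 0\<close> and to \<open>0 * b\<close> shows
  that \<open>f\<close> commutes with \<open>\<phi>\<close> and with \<open>\<delta>\<close>, and applying it to \<open>a * b\<close> then gives
  \<open>f(\<phi>(a) + \<delta>(b)) = f(\<phi>(a)) + f(\<delta>(b))\<close>. As \<open>\<phi>\<close> and \<open>\<delta>\<close> are both onto, \<open>f\<close> is additive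
  (\<open>qauto_fixing_one\<close>).

  All translations are quandle automorphisms, so a quandle automorphism is a translation after one
  that fixes \<open>0\<close>, that is, an affine map \<open>x \<mapsto> a + f(x)\<close> with \<open>f\<close> in the centraliser of \<open>\<phi>\<close>.
  Sending \<open>(a, f)\<close> to this affine map is an injective homomorphism on the holomorph of \<open>G\<close>, and its
  restriction to \<open>G \<rtimes> C(\<phi>)\<close> is the isomorphism onto the automorphism group (\<open>affine_iso_QAutoGroup\<close>).

  Under this isomorphism \<open>S\<^sub>x\<close>, the map \<open>y \<mapsto> \<delta>(x) + \<phi>(y)\<close>, corresponds to \<open>(\<delta>(x), \<phi>)\<close>. Since \<open>\<delta>\<close>
  is onto, the inner automorphism group corresponds to the subgroup generated by all \<open>(a, \<phi>)\<close>.
  Quotients of two such pairs give every \<open>(a, 1)\<close>, so this subgroup is \<open>G \<rtimes> \<langle>\<phi>\<rangle>\<close>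
  (\<open>generate_semidirect\<close>).\<close>

section \<open>Semidirect products and affine maps\<close>

definition affine :: "('a, 'b) monoid_scheme \<Rightarrow> 'a \<times> ('a \<Rightarrow> 'a) \<Rightarrow> 'a \<Rightarrow> 'a"
  where "affine G = (\<lambda>(a, f). \<lambda>x\<in>carrier G. a \<otimes>\<^bsub>G\<^esub> f x)"

context group
begin

lemma mult_AutoGroup_apply:
  assumes "f \<in> auto G" "g \<in> auto G" "x \<in> carrier G"
  shows "(f \<otimes>\<^bsub>AutoGroup G\<^esub> g) x = f (g x)"
  using assms by (simp add: AutoGroup_def BijGroup_def auto_def compose_eq)

lemma one_AutoGroup_apply: "x \<in> carrier G \<Longrightarrow> \<one>\<^bsub>AutoGroup G\<^esub> x = x"
  by (simp add: AutoGroup_def BijGroup_def)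

lemma carrier_AutoGroup: "carrier (AutoGroup G) = auto G"
  by (simp add: AutoGroup_def)

lemma auto_closed: "f \<in> auto G \<Longrightarrow> x \<in> carrier G \<Longrightarrow> f x \<in> carrier G"
  by (auto simp: auto_def hom_def)

lemma auto_mult: "f \<in> auto G \<Longrightarrow> x \<in> carrier G \<Longrightarrow> y \<in> carrier G \<Longrightarrow> f (x \<otimes> y) = f x \<otimes> f y"
  by (auto simp: auto_def hom_def)

lemma auto_one: "f \<in> auto G \<Longrightarrow> f \<one> = \<one>"
  by (simp add: auto_def hom_one)

lemma auto_inv: "f \<in> auto G \<Longrightarrow> x \<in> carrier G \<Longrightarrow> f (inv x) = inv (f x)"
  using group_hom.hom_inv[of G G f x]
  by (simp add: auto_def group_hom_def group_hom_axioms_def)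

lemma auto_bij: "f \<in> auto G \<Longrightarrow> bij_betw f (carrier G) (carrier G)"
  by (simp add: auto_def Bij_def)

lemma affine_Bij:
  assumes "a \<in> carrier G" "f \<in> auto G"
  shows "affine G (a, f) \<in> Bij (carrier G)"
proof -
  have "bij_betw ((\<lambda>x. a \<otimes> x) \<circ> f) (carrier G) (carrier G)"
  proof (rule bij_betw_trans[OF auto_bij[OF assms(2)]])
    show "bij_betw (\<lambda>x. a \<otimes> x) (carrier G) (carrier G)"
      using assms(1) by (simp add: bij_betw_def inj_on_multc inj_on_cmult surj_const_mult)
  qed
  then have "bij_betw (affine G (a, f)) (carrier G) (carrier G)"
    by (rule bij_betw_cong[THEN iffD1, rotated]) (simp add: affine_def)
  then show ?thesis
    by (simp add: Bij_def affine_def)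
qed

text \<open>Composing affine maps is what the twisted multiplication of the semidirect product encodes:
  \<open>a\<^sub>1 + f\<^sub>1(a\<^sub>2 + f\<^sub>2(x)) = (a\<^sub>1 + f\<^sub>1(a\<^sub>2)) + f\<^sub>1(f\<^sub>2(x))\<close>.\<close>

lemma affine_semidirect_mult:
  assumes "H \<subseteq> auto G" "p \<in> carrier (semidirect G H)" "q \<in> carrier (semidirect G H)"
  shows "affine G (p \<otimes>\<^bsub>semidirect G H\<^esub> q)
    = affine G p \<otimes>\<^bsub>BijGroup (carrier G)\<^esub> affine G q"
proof -
  obtain a f b g where [simp]: "p = (a, f)" "q = (b, g)"
    by (cases p, cases q)
  have ab [simp]: "a \<in> carrier G" "b \<in> carrier G" and fg [simp]: "f \<in> auto G" "g \<in> auto G"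
    using assms by (auto simp: semidirect_def)
  have "affine G (a \<otimes> f b, f \<otimes>\<^bsub>AutoGroup G\<^esub> g)
      = compose (carrier G) (affine G (a, f)) (affine G (b, g))"
    by (rule ext)
      (auto simp: affine_def compose_def mult_AutoGroup_apply auto_mult auto_closed m_assoc)
  then show ?thesis
    by (simp add: semidirect_def BijGroup_def affine_Bij)
qed

text \<open>The value at the identity recovers the translation part, and then cancellation recovers the
  automorphism.\<close>

lemma inj_on_affine: "inj_on (affine G) (carrier G \<times> auto G)"
proof (rule inj_onI, clarify, rule conjI)
  fix a f b g
  assume ab: "a \<in> carrier G" "b \<in> carrier G" and fg: "f \<in> auto G" "g \<in> auto G"
    and eq: "affine G (a, f) = affine G (b, g)"
  have app: "a \<otimes> f x = b \<otimes> g x" if "x \<in> carrier G" for x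
    using fun_cong[OF eq, of x] that by (simp add: affine_def)
  from app[of \<one>] show "a = b"
    using ab fg by (simp add: auto_one)
  with app ab fg have "f x = g x" if "x \<in> carrier G" for x
    using that by (simp add: auto_closed)
  then show "f = g"
    using fg by (intro extensionalityI[of _ "carrier G"]) (auto simp: auto_def Bij_def)
qed

text \<open>Projecting to the automorphism part determines which second components occur, and the
  quotients of two generators supply all first components.\<close>

lemma generate_semidirect:
  assumes H: "subgroup H (AutoGroup G)" and \<phi>: "\<phi> \<in> H"
  shows "generate (semidirect G H) (carrier G \<times> {\<phi>})
    = carrier G \<times> generate (AutoGroup G) {\<phi>}" (is "?U = _")
proof -
  let ?K = "semidirect G H"
  interpret A: group "AutoGroup G" by (rule AutoGroup)
  interpret H: subgroup H "AutoGroup G" by (rule H)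
  interpret K: group ?K by (rule group_semidirect[OF H])
  have H_auto: "H \<subseteq> auto G"
    using H.subset by (simp add: carrier_AutoGroup)
  have sub: "carrier G \<times> {\<phi>} \<subseteq> carrier ?K"
    using \<phi> by (auto simp: semidirect_def)
  interpret U: subgroup ?U ?K
    by (rule K.generate_is_subgroup[OF sub])
  have "group_hom ?K (AutoGroup G) snd"
    by unfold_locales (auto simp: hom_def semidirect_def)
  moreover have "snd ` (carrier G \<times> {\<phi>}) = {\<phi>}"
    using one_closed by force
  ultimately have snd_U: "snd ` ?U = generate (AutoGroup G) {\<phi>}"
    using group_hom.generate_img[of ?K "AutoGroup G" snd, OF _ sub] by simp
  have transl: "(a, \<one>\<^bsub>AutoGroup G\<^esub>) \<in> ?U" if a: "a \<in> carrier G" for a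
  proof -
    have gen: "(a, \<phi>) \<in> ?U" "(\<one>, \<phi>) \<in> ?U"
      using a by (auto intro: generate.incl)
    have "(a, \<one>\<^bsub>AutoGroup G\<^esub>) \<otimes>\<^bsub>?K\<^esub> (\<one>, \<phi>) = (a, \<phi>)"
      using a \<phi> by (simp add: semidirect_def one_AutoGroup_apply)
    then have "(a, \<one>\<^bsub>AutoGroup G\<^esub>) = (a, \<phi>) \<otimes>\<^bsub>?K\<^esub> inv\<^bsub>?K\<^esub> (\<one>, \<phi>)"
      using a \<phi> by (intro K.inv_solve_right[THEN iffD2]) (auto simp: semidirect_def)
    then show ?thesis
      using U.m_closed[OF gen(1) U.m_inv_closed[OF gen(2)]] by simp
  qed
  show ?thesis
  proof
    show "?U \<subseteq> carrier G \<times> generate (AutoGroup G) {\<phi>}"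
    proof
      fix p assume p: "p \<in> ?U"
      then have "fst p \<in> carrier G"
        using U.subset by (auto simp: semidirect_def)
      moreover have "snd p \<in> generate (AutoGroup G) {\<phi>}"
        using p snd_U by blast
      ultimately show "p \<in> carrier G \<times> generate (AutoGroup G) {\<phi>}"
        by (simp add: mem_Times_iff)
    qed
    show "carrier G \<times> generate (AutoGroup G) {\<phi>} \<subseteq> ?U"
    proof clarify
      fix a f assume a: "a \<in> carrier G" and "f \<in> generate (AutoGroup G) {\<phi>}"
      then obtain b where bf: "(b, f) \<in> ?U"
        using snd_U by force
      then have b: "b \<in> carrier G" and f: "f \<in> H"
        using U.subset by (auto simp: semidirect_def)
      have "(a \<otimes> inv b, \<one>\<^bsub>AutoGroup G\<^esub>) \<otimes>\<^bsub>?K\<^esub> (b, f) = (a, f)"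
        using a b f by (simp add: semidirect_def one_AutoGroup_apply m_assoc)
      then show "(a, f) \<in> ?U"
        using U.m_closed[OF transl bf, of "a \<otimes> inv b"] a b by simp
    qed
  qed
qed

end


section \<open>Automorphisms of Alexander quandles\<close>

locale alexander = comm_group G for G :: "('a, 'b) monoid_scheme" (structure) +
  fixes \<phi> :: "'a \<Rightarrow> 'a"
  assumes phi_auto: "\<phi> \<in> auto G"
begin

text \<open>The part of the quandle operation that depends on the right argument: \<open>a * b = \<phi>(a) + \<delta>(b)\<close>.\<close>

definition \<delta> :: "'a \<Rightarrow> 'a"
  where "\<delta> b = inv (\<phi> b) \<otimes> b"

lemmas phi_simps [simp] =
  auto_closed[OF phi_auto] auto_mult[OF phi_auto] auto_one[OF phi_auto] auto_inv[OF phi_auto]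

lemma delta_closed [simp]: "b \<in> carrier G \<Longrightarrow> \<delta> b \<in> carrier G"
  by (simp add: \<delta>_def)

lemma delta_one [simp]: "\<delta> \<one> = \<one>"
  by (simp add: \<delta>_def)

lemma delta_mult: "a \<in> carrier G \<Longrightarrow> b \<in> carrier G \<Longrightarrow> \<delta> (a \<otimes> b) = \<delta> a \<otimes> \<delta> b"
  by (simp add: \<delta>_def inv_mult m_ac)

lemma phi_delta: "a \<in> carrier G \<Longrightarrow> \<phi> a \<otimes> \<delta> a = a"
  by (simp add: \<delta>_def m_assoc[symmetric])

lemma carrier_Alex [simp]: "carrier (Alex G \<phi>) = carrier G"
  by (simp add: Alex_def)

lemma op_Alex: "a \<in> carrier G \<Longrightarrow> b \<in> carrier G \<Longrightarrow> a \<triangleright>\<^bsub>Alex G \<phi>\<^esub> b = \<phi> a \<otimes> \<delta> b"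
  by (simp add: Alex_def \<delta>_def m_assoc)

lemma delta_surj:
  assumes "finite (carrier G)" "fixed_point_free G \<phi>"
  shows "\<delta> ` carrier G = carrier G"
proof (rule endo_inj_surj[OF assms(1)])
  interpret d: group_hom G G \<delta>
    by unfold_locales (simp add: hom_def delta_mult)
  have "a = \<one>" if a: "a \<in> carrier G" "\<delta> a = \<one>" for a
  proof -
    have "\<phi> a = a"
      using phi_delta[OF a(1)] a by simp
    then show ?thesis
      using assms(2) a(1) unfolding fixed_point_free_def by blast
  qed
  then show "inj_on \<delta> (carrier G)"
    unfolding d.inj_on_one_iff by blast
qed auto

lemma centraliser_iff:
  "f \<in> centraliser (AutoGroup G) \<phi> \<longleftrightarrow> f \<in> auto G \<and> (\<forall>x\<in>carrier G. f (\<phi> x) = \<phi> (f x))"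
proof -
  have "f \<otimes>\<^bsub>AutoGroup G\<^esub> \<phi> = \<phi> \<otimes>\<^bsub>AutoGroup G\<^esub> f \<longleftrightarrow> (\<forall>x\<in>carrier G. f (\<phi> x) = \<phi> (f x))"
    if f: "f \<in> auto G"
  proof -
    have "f \<otimes>\<^bsub>AutoGroup G\<^esub> \<phi> = compose (carrier G) f \<phi>"
      "\<phi> \<otimes>\<^bsub>AutoGroup G\<^esub> f = compose (carrier G) \<phi> f"
      using f phi_auto by (simp_all add: AutoGroup_def BijGroup_def auto_def)
    then show ?thesis
      by (auto simp: compose_def fun_eq_iff)
  qed
  then show ?thesis
    by (auto simp: centraliser_def carrier_AutoGroup)
qed

lemma subgroup_centraliser_phi: "subgroup (centraliser (AutoGroup G) \<phi>) (AutoGroup G)"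
  using phi_auto by (intro group.subgroup_centraliser AutoGroup) (simp add: carrier_AutoGroup)

lemma qauto_iff:
  "f \<in> qauto (Alex G \<phi>) \<longleftrightarrow> f \<in> Bij (carrier G)
    \<and> (\<forall>a\<in>carrier G. \<forall>b\<in>carrier G. f (\<phi> a \<otimes> \<delta> b) = \<phi> (f a) \<otimes> \<delta> (f b))"
  by (auto simp: qauto_def op_Alex Bij_imp_funcset[THEN funcset_mem])

text \<open>The linear part commutes with \<open>\<phi>\<close>, hence with \<open>\<delta>\<close>. The translation part is harmless
  because \<open>a\<close> splits as \<open>\<phi>(a) + \<delta>(a)\<close>, and commutativity of the group lets the two summands move
  into the arguments of \<open>\<phi>\<close> and \<open>\<delta>\<close>.\<close>

lemma affine_qauto:
  assumes a: "a \<in> carrier G" and f: "f \<in> centraliser (AutoGroup G) \<phi>"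
  shows "affine G (a, f) \<in> qauto (Alex G \<phi>)"
proof -
  have fA: "f \<in> auto G" and comm: "\<And>x. x \<in> carrier G \<Longrightarrow> f (\<phi> x) = \<phi> (f x)"
    using f by (auto simp: centraliser_iff)
  have "a \<otimes> f (\<phi> x \<otimes> \<delta> y) = \<phi> (a \<otimes> f x) \<otimes> \<delta> (a \<otimes> f y)"
    if "x \<in> carrier G" "y \<in> carrier G" for x y
  proof -
    have [simp]: "f x \<in> carrier G" "f y \<in> carrier G"
      using that fA by (simp_all add: auto_closed)
    have "f (\<delta> y) = \<delta> (f y)"
      using that fA comm by (simp add: \<delta>_def auto_mult auto_inv)
    then have "a \<otimes> f (\<phi> x \<otimes> \<delta> y) = (\<phi> a \<otimes> \<delta> a) \<otimes> (\<phi> (f x) \<otimes> \<delta> (f y))"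
      using that a fA comm by (simp add: auto_mult phi_delta)
    also have "\<dots> = \<phi> (a \<otimes> f x) \<otimes> \<delta> (a \<otimes> f y)"
      using a by (simp add: delta_mult m_ac)
    finally show ?thesis .
  qed
  then show ?thesis
    using affine_Bij[OF a fA] by (auto simp: qauto_iff affine_def)
qed

text \<open>With \<open>0\<close> as one argument the quandle operation reduces to \<open>\<phi>\<close> or to \<open>\<delta>\<close>, so a quandle
  automorphism fixing \<open>0\<close> commutes with both; additivity holds for sums \<open>\<phi>(a) + \<delta>(b)\<close>, and by
  surjectivity every pair of summands has this form.\<close>

lemma qauto_fixing_one:
  assumes surj: "\<delta> ` carrier G = carrier G"
  shows "centraliser (AutoGroup G) \<phi> = qauto_fixing (Alex G \<phi>) \<one>"
proof
  show "centraliser (AutoGroup G) \<phi> \<subseteq> qauto_fixing (Alex G \<phi>) \<one>"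
  proof
    fix f assume f: "f \<in> centraliser (AutoGroup G) \<phi>"
    then have fA: "f \<in> auto G" by (simp add: centraliser_iff)
    have "affine G (\<one>, f) = f"
      using fA by (intro extensionalityI[of _ "carrier G"])
        (auto simp: affine_def auto_closed auto_def Bij_def)
    then show "f \<in> qauto_fixing (Alex G \<phi>) \<one>"
      using affine_qauto[OF one_closed f] fA by (simp add: qauto_fixing_def auto_one)
  qed
next
  show "qauto_fixing (Alex G \<phi>) \<one> \<subseteq> centraliser (AutoGroup G) \<phi>"
  proof
    fix f assume "f \<in> qauto_fixing (Alex G \<phi>) \<one>"
    then have bij: "f \<in> Bij (carrier G)" and one: "f \<one> = \<one>"
      and q: "\<And>a b. a \<in> carrier G \<Longrightarrow> b \<in> carrier G \<Longrightarrow> f (\<phi> a \<otimes> \<delta> b) = \<phi> (f a) \<otimes> \<delta> (f b)"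
      by (auto simp: qauto_fixing_def qauto_iff)
    have cl [simp]: "a \<in> carrier G \<Longrightarrow> f a \<in> carrier G" for a
      using bij Bij_imp_funcset by blast
    have phi: "f (\<phi> a) = \<phi> (f a)" if "a \<in> carrier G" for a
      using q[OF that one_closed] that one by simp
    have del: "f (\<delta> b) = \<delta> (f b)" if "b \<in> carrier G" for b
      using q[OF one_closed that] that one by simp
    have "f (x \<otimes> y) = f x \<otimes> f y" if x: "x \<in> carrier G" and y: "y \<in> carrier G" for x y
    proof -
      obtain a b where "a \<in> carrier G" "x = \<phi> a" "b \<in> carrier G" "y = \<delta> b"
        using x y surj auto_bij[OF phi_auto] unfolding bij_betw_def by (metis imageE)
      then show ?thesis
        by (simp add: q phi del)
    qed
    then have "f \<in> auto G"
      using bij by (simp add: auto_def hom_def)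
    then show "f \<in> centraliser (AutoGroup G) \<phi>"
      using phi by (simp add: centraliser_iff)
  qed
qed

lemma affine_image:
  assumes surj: "\<delta> ` carrier G = carrier G"
  shows "affine G ` (carrier G \<times> centraliser (AutoGroup G) \<phi>) = qauto (Alex G \<phi>)"
proof
  show "affine G ` (carrier G \<times> centraliser (AutoGroup G) \<phi>) \<subseteq> qauto (Alex G \<phi>)"
    using affine_qauto by auto
next
  interpret Q: quandle "Alex G \<phi>" by (rule quandle_Alex[OF phi_auto])
  interpret QA: subgroup "qauto (Alex G \<phi>)" "BijGroup (carrier G)"
    using Q.subgroup_qauto by simp
  show "qauto (Alex G \<phi>) \<subseteq> affine G ` (carrier G \<times> centraliser (AutoGroup G) \<phi>)"
  proof
    fix f assume f: "f \<in> qauto (Alex G \<phi>)"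
    then have fB: "f \<in> Bij (carrier G)" by (simp add: qauto_iff)
    have cl [simp]: "x \<in> carrier G \<Longrightarrow> f x \<in> carrier G" for x
      using fB Bij_imp_funcset by blast
    \<comment> \<open>Translating \<open>f(0)\<close> back to \<open>0\<close> leaves the linear part.\<close>
    define t where "t = affine G (inv (f \<one>), \<one>\<^bsub>AutoGroup G\<^esub>)"
    define g where "g = t \<otimes>\<^bsub>BijGroup (carrier G)\<^esub> f"
    have t: "t \<in> qauto (Alex G \<phi>)"
      unfolding t_def
      by (rule affine_qauto) (simp_all add: subgroup.one_closed[OF subgroup_centraliser_phi])
    have g_app: "g x = inv (f \<one>) \<otimes> f x" if "x \<in> carrier G" for x
      using that t fB
      by (simp add: g_def t_def BijGroup_def qauto_iff compose_eq affine_def one_AutoGroup_apply)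
    have "g \<in> qauto_fixing (Alex G \<phi>) \<one>"
      using QA.m_closed[OF t f] g_app[of \<one>] by (simp add: qauto_fixing_def g_def)
    then have gC: "g \<in> centraliser (AutoGroup G) \<phi>"
      by (simp add: qauto_fixing_one[OF surj])
    have "affine G (f \<one>, g) = f"
      using fB by (intro extensionalityI[of _ "carrier G"])
        (auto simp: affine_def g_app Bij_def m_assoc[symmetric])
    then show "f \<in> affine G ` (carrier G \<times> centraliser (AutoGroup G) \<phi>)"
      using gC by (metis SigmaI cl image_eqI one_closed)
  qed
qed

lemma affine_iso_QAutoGroup:
  assumes surj: "\<delta> ` carrier G = carrier G"
  shows "affine G \<in> iso (semidirect G (centraliser (AutoGroup G) \<phi>)) (QAutoGroup (Alex G \<phi>))"
proof -
  have C: "centraliser (AutoGroup G) \<phi> \<subseteq> auto G"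
    by (auto simp: centraliser_iff)
  have "bij_betw (affine G) (carrier G \<times> centraliser (AutoGroup G) \<phi>) (qauto (Alex G \<phi>))"
    using inj_on_subset[OF inj_on_affine Sigma_mono[OF order_refl C]] affine_image[OF surj]
    by (simp add: bij_betw_def)
  moreover have "affine G \<in>
      hom (semidirect G (centraliser (AutoGroup G) \<phi>)) (QAutoGroup (Alex G \<phi>))"
    using affine_semidirect_mult[OF C] affine_qauto
    by (auto simp: hom_def QAutoGroup_def semidirect_def)
  ultimately show ?thesis
    by (simp add: iso_def QAutoGroup_def semidirect_def)
qed

lemma right_mult_Alex: "x \<in> carrier G \<Longrightarrow> right_mult (Alex G \<phi>) x = affine G (\<delta> x, \<phi>)"
  by (rule ext) (simp add: right_mult_def affine_def op_Alex m_comm)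

text \<open>The isomorphism of the whole automorphism group matches the right multiplications with the
  pairs \<open>(\<delta>(x), \<phi>)\<close>, which are all pairs \<open>(a, \<phi>)\<close> by surjectivity, so it matches the subgroups that
  these two sets generate.\<close>

lemma affine_iso_QInnGroup:
  assumes surj: "\<delta> ` carrier G = carrier G"
  shows "affine G \<in> iso (semidirect G (generate (AutoGroup G) {\<phi>})) (QInnGroup (Alex G \<phi>))"
proof -
  let ?C = "centraliser (AutoGroup G) \<phi>"
  let ?K = "semidirect G ?C" and ?A = "QAutoGroup (Alex G \<phi>)"
  let ?P = "generate (AutoGroup G) {\<phi>}"
  note sub = subgroup_centraliser_phi
  have iso: "affine G \<in> iso ?K ?A"
    by (rule affine_iso_QAutoGroup[OF surj])
  have phi_C: "\<phi> \<in> ?C"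
    by (simp add: centraliser_iff phi_auto)
  interpret K: group ?K by (rule group_semidirect[OF sub])
  interpret Q: quandle "Alex G \<phi>" by (rule quandle_Alex[OF phi_auto])
  interpret h: group_hom ?K ?A "affine G"
    using iso Q.group_QAutoGroup K.is_group
    by (simp add: group_hom_def group_hom_axioms_def iso_def)
  have "right_mult (Alex G \<phi>) ` carrier G = (\<lambda>x. affine G (x, \<phi>)) ` \<delta> ` carrier G"
    by (auto simp: right_mult_Alex)
  also have "\<dots> = affine G ` (carrier G \<times> {\<phi>})"
    unfolding surj by auto
  finally have "generate ?A (right_mult (Alex G \<phi>) ` carrier G)
      = affine G ` generate ?K (carrier G \<times> {\<phi>})"
    using h.generate_img[of "carrier G \<times> {\<phi>}"] phi_C by (auto simp: semidirect_def)
  also have "\<dots> = affine G ` (carrier G \<times> ?P)"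
    by (simp add: generate_semidirect[OF sub phi_C])
  finally have Inn: "QInnGroup (Alex G \<phi>) = ?A\<lparr>carrier := affine G ` (carrier G \<times> ?P)\<rparr>"
    by (simp add: QInnGroup_def)
  have P: "?P \<subseteq> ?C"
    using group.generate_subgroup_incl[OF AutoGroup _ sub] phi_C by simp
  then have "?P \<subseteq> auto G"
    by (auto simp: centraliser_iff)
  then have "inj_on (affine G) (carrier G \<times> ?P)"
    by (intro inj_on_subset[OF inj_on_affine]) auto
  moreover have "affine G \<in> hom (semidirect G ?P) (QInnGroup (Alex G \<phi>))"
  proof (rule homI)
    fix p q assume "p \<in> carrier (semidirect G ?P)" "q \<in> carrier (semidirect G ?P)"
    then have "p \<in> carrier ?K" "q \<in> carrier ?K"
      using P by (auto simp: semidirect_def)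
    then show "affine G (p \<otimes>\<^bsub>semidirect G ?P\<^esub> q)
        = affine G p \<otimes>\<^bsub>QInnGroup (Alex G \<phi>)\<^esub> affine G q"
      using h.hom_mult by (simp add: Inn semidirect_def)
  qed (simp add: Inn semidirect_def)
  ultimately show ?thesis
    by (simp add: iso_def bij_betw_def Inn semidirect_def)
qed

end


section \<open>The three descriptions\<close>

theorem theorem6p1:
  fixes G :: "('a, 'b) monoid_scheme" and \<phi> :: "'a \<Rightarrow> 'a"
  assumes "comm_group G" and "finite (carrier G)"
    and "\<phi> \<in> auto G" and "fixed_point_free G \<phi>"
  shows "centraliser (AutoGroup G) \<phi> = qauto_fixing (Alex G \<phi>) \<one>\<^bsub>G\<^esub>
    \<and> QAutoGroup (Alex G \<phi>) \<cong> semidirect G (centraliser (AutoGroup G) \<phi>)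
    \<and> QInnGroup (Alex G \<phi>) \<cong> semidirect G (generate (AutoGroup G) {\<phi>})"
proof -
  interpret alexander G \<phi>
    using assms by (simp add: alexander_def alexander_axioms_def)
  have surj: "\<delta> ` carrier G = carrier G"
    by (rule delta_surj[OF assms(2,4)])
  have "subgroup (generate (AutoGroup G) {\<phi>}) (AutoGroup G)"
    using assms(3) by (intro group.generate_is_subgroup AutoGroup) (simp add: carrier_AutoGroup)
  then have "QInnGroup (Alex G \<phi>) \<cong> semidirect G (generate (AutoGroup G) {\<phi>})"
    by (rule group.iso_sym[OF group_semidirect is_isoI[OF affine_iso_QInnGroup[OF surj]]])
  moreover have "QAutoGroup (Alex G \<phi>) \<cong> semidirect G (centraliser (AutoGroup G) \<phi>)"
    by (rule group.iso_sym[OF group_semidirect[OF subgroup_centraliser_phi]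
          is_isoI[OF affine_iso_QAutoGroup[OF surj]]])
  ultimately show ?thesis
    using qauto_fixing_one[OF surj] by simp
qed

end
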